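(* Let $n,p\ge1$. If $\mathcal{H}\in\mathbb{C}^{2n\times2n\times p}$ is a T-Hamiltonian tensor, then $\mathcal{S}=\exp(\mathcal{H})$ is a T-symplectic tensor.
   Context: A tensor $\mathcal{A}\in\mathbb{C}^{m\times n\times p}$ has frontal slices $\boldsymbol{A}^{(1)},\dots,\boldsymbol{A}^{(p)}\in\mathbb{C}^{m\times n}$. With $\omega=e^{2\pi\sqrt{-1}/p}$, its Fourier-domain slices are $\widehat{\boldsymbol{A}}^{(i)}=\sum_{j=1}^{p}\omega^{(i-1)(j-1)}\boldsymbol{A}^{(j)}$, $i=1,\dots,p$. Let $\operatorname{bcirc}(\mathcal{A})\in\mathbb{C}^{mp\times np}$ be the block circulant matrix whose $(r,s)$ block is $\boldsymbol{A}^{(((r-s)\bmod p)+1)}$. The T-product $\mathcal{A}*\mathcal{B}$ is the tensor with $\operatorname{bcirc}(\mathcal{A}*\mathcal{B})=\operatorname{bcirc}(\mathcal{A})\operatorname{bcirc}(\mathcal{B})$; equivalently, if $\mathcal{C}=\mathcal{A}*\mathcal{B}$ then $\widehat{\boldsymbol{C}}^{(i)}=\widehat{\boldsymbol{A}}^{(i)}\widehat{\boldsymbol{B}}^{(i)}$ for all $i$. The T-conjugate transpose $\mathcal{A}^H$ has frontal slices $(\boldsymbol{A}^{(1)})^H$ for $k=1$ and $(\boldsymbol{A}^{(p-k+2)})^H$ for $k\ge2$ (so that $\operatorname{bcirc}(\mathcal{A}^H)=\operatorname{bcirc}(\mathcal{A})^H$). The identity tensor $\mathcal{I}_{m,p}\in\mathbb{R}^{m\times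 m\times p}$ has first frontal slice $\boldsymbol{I}_m$ and all other frontal slices zero. Let $\boldsymbol{J}=\begin{bmatrix}\boldsymbol{0}&\boldsymbol{I}_n\\-\boldsymbol{I}_n&\boldsymbol{0}\end{bmatrix}$. The T-symplectic unit tensor $\mathcal{J}\in\mathbb{R}^{2n\times2n\times p}$ is the tensor all of whose Fourier-domain slices equal $\boldsymbol{J}$. A tensor $\mathcal{H}\in\mathbb{C}^{2n\times2n\times p}$ is T-Hamiltonian if $(\mathcal{J}*\mathcal{H})^H=\mathcal{J}*\mathcal{H}$; a tensor $\mathcal{S}\in\mathbb{C}^{2n\times2n\times p}$ is T-symplectic if $\mathcal{S}^H*\mathcal{J}*\mathcal{S}=\mathcal{J}$. The tensor exponential is the absolutely convergent series $\exp(\mathcal{H})=\sum_{k=0}^\infty\frac1{k!}\mathcal{H}^{*k}$, where $\mathcal{H}^{*0}=\mathcal{I}_{2n,p}$ and $\mathcal{H}^{*k}$ is the $k$-fold T-product of $\mathcal{H}$ with itself; equivalently, the $i$-th Fourier-domain slice of $\exp(\mathcal{H})$ is the matrix exponential $\exp(\widehat{\boldsymbol{H}}^{(i)})$ for $i=1,\dots,p$. *)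

theory Defs
  imports Complex_Main "Jordan_Normal_Form.Schur_Decomposition"
begin

section \<open>Third-order tensors and the T-product\<close>

text \<open>
  A tensor is the list of its frontal slices. Slices and blocks are numbered from 0, so the
  \<open>i\<close>-th slice of the literature is \<open>A ! (i - 1)\<close>. The number of rows and columns is read off
  the slices, which is meaningful because only tensors with at least one slice matter.
\<close>

type_synonym 'a tensor = "'a mat list"

definition carrier_tensor :: "nat \<Rightarrow> nat \<Rightarrow> nat \<Rightarrow> 'a tensor set" where
  "carrier_tensor m n p = {A. length A = p \<and> set A \<subseteq> carrier_mat m n}"

definition t_rows :: "'a tensor \<Rightarrow> nat" where
  "t_rows A = dim_row (hd A)"

definition t_cols :: "'a tensor \<Rightarrow> nat" where
  "t_cols A = dim_col (hd A)"

text \<open>The block in position \<open>(r, s)\<close> is the slice \<open>(r - s) mod p\<close>; as \<open>s < p\<close>, adding \<open>p\<close> keeps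
  the subtraction of natural numbers exact.\<close>

definition bcirc :: "'a tensor \<Rightarrow> 'a mat" where
  "bcirc A = (let m = t_rows A; n = t_cols A; p = length A in
     mat (m * p) (n * p)
       (\<lambda>(i, j). (A ! ((i div m + p - j div n) mod p)) $$ (i mod m, j mod n)))"

text \<open>A block circulant matrix is determined by its first block column, so the T-product is
  read off the first block column of \<open>bcirc A * bcirc B\<close>. Its characterisation by
  \<open>bcirc (A *\<^sub>T B) = bcirc A * bcirc B\<close> is lemma \<open>t_prod_unique\<close> below.\<close>

definition t_prod :: "'a::semiring_0 tensor \<Rightarrow> 'a tensor \<Rightarrow> 'a tensor" (infixl "*\<^sub>T" 70) where
  "A *\<^sub>T B = map (\<lambda>k. mat (t_rows A) (t_cols B)
       (\<lambda>(i, j). (bcirc A * bcirc B) $$ (k * t_rows A + i, j))) [0..<length A]"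

definition t_one :: "nat \<Rightarrow> nat \<Rightarrow> 'a::{zero,one} tensor" where
  "t_one m p = map (\<lambda>k. if k = 0 then 1\<^sub>m m else 0\<^sub>m m m) [0..<p]"

definition t_adjoint :: "complex tensor \<Rightarrow> complex tensor" where
  "t_adjoint A = map (\<lambda>k. mat_adjoint (if k = 0 then A ! 0 else A ! (length A - k))) [0..<length A]"

primrec t_pow :: "'a::semiring_1 tensor \<Rightarrow> nat \<Rightarrow> 'a tensor" where
  "t_pow A 0 = t_one (t_rows A) (length A)"
| "t_pow A (Suc k) = t_pow A k *\<^sub>T A"

text \<open>The exponential series is summed entrywise; it converges absolutely by lemma
  \<open>t_exp_abs_summable\<close> below.\<close>

definition t_exp :: "complex tensor \<Rightarrow> complex tensor" where
  "t_exp A = map (\<lambda>s. mat (t_rows A) (t_rows A)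
       (\<lambda>(i, j). \<Sum>k. 1 / fact k * (t_pow A k ! s) $$ (i, j))) [0..<length A]"


section \<open>Fourier-domain slices, T-Hamiltonian and T-symplectic tensors\<close>

definition root_unity :: "nat \<Rightarrow> complex" where
  "root_unity p = exp (2 * of_real pi * \<i> / of_nat p)"

definition fourier_slice :: "complex tensor \<Rightarrow> nat \<Rightarrow> complex mat" where
  "fourier_slice A i = mat (t_rows A) (t_cols A)
     (\<lambda>(r, c). \<Sum>j<length A. root_unity (length A) ^ (i * j) * (A ! j) $$ (r, c))"

definition J_mat :: "nat \<Rightarrow> complex mat" where
  "J_mat n = four_block_mat (0\<^sub>m n n) (1\<^sub>m n) (- 1\<^sub>m n) (0\<^sub>m n n)"

text \<open>Existence and uniqueness of this tensor are lemma \<open>t_J_unique\<close> below.\<close>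

definition t_J :: "nat \<Rightarrow> nat \<Rightarrow> complex tensor" where
  "t_J n p = (THE A. A \<in> carrier_tensor (2 * n) (2 * n) p \<and> (\<forall>i<p. fourier_slice A i = J_mat n))"

definition t_hamiltonian :: "nat \<Rightarrow> nat \<Rightarrow> complex tensor \<Rightarrow> bool" where
  "t_hamiltonian n p H \<longleftrightarrow> H \<in> carrier_tensor (2 * n) (2 * n) p \<and>
     t_adjoint (t_J n p *\<^sub>T H) = t_J n p *\<^sub>T H"

definition t_symplectic :: "nat \<Rightarrow> nat \<Rightarrow> complex tensor \<Rightarrow> bool" where
  "t_symplectic n p S \<longleftrightarrow> S \<in> carrier_tensor (2 * n) (2 * n) p \<and>
     t_adjoint S *\<^sub>T t_J n p *\<^sub>T S = t_J n p"


section \<open>Well-definedness\<close>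

lemma carrier_tensorD:
  assumes "A \<in> carrier_tensor m n p"
  shows "length A = p" "k < p \<Longrightarrow> A ! k \<in> carrier_mat m n"
    "0 < p \<Longrightarrow> t_rows A = m" "0 < p \<Longrightarrow> t_cols A = n"
proof -
  show l: "length A = p" using assms by (simp add: carrier_tensor_def)
  show k: "A ! k \<in> carrier_mat m n" if "k < p" for k
    using assms that nth_mem[of k A] by (auto simp: carrier_tensor_def)
  show "0 < p \<Longrightarrow> t_rows A = m" "0 < p \<Longrightarrow> t_cols A = n"
    using k[of 0] l by (auto simp: t_rows_def t_cols_def hd_conv_nth)
qed

lemma carrier_tensorI:
  assumes "length A = p" "\<And>k. k < p \<Longrightarrow> A ! k \<in> carrier_mat m n"
  shows "A \<in> carrier_tensor m n p"
  using assms by (auto simp: carrier_tensor_def in_set_conv_nth)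

lemma tensor_eqI:
  assumes "A \<in> carrier_tensor m n p" "B \<in> carrier_tensor m n p"
    and "\<And>k i j. k < p \<Longrightarrow> i < m \<Longrightarrow> j < n \<Longrightarrow> A ! k $$ (i, j) = B ! k $$ (i, j)"
  shows "A = B"
proof (rule nth_equalityI)
  show "length A = length B" using assms(1,2) by (simp add: carrier_tensorD)
  fix k assume "k < length A"
  then have k: "k < p" using assms(1) by (simp add: carrier_tensorD)
  show "A ! k = B ! k"
    using carrier_tensorD(2)[OF assms(1) k] carrier_tensorD(2)[OF assms(2) k] assms(3)[OF k]
    by (intro eq_matI) auto
qed

lemma bcirc_carrier:
  assumes "A \<in> carrier_tensor m n p" "0 < p"
  shows "bcirc A \<in> carrier_mat (m * p) (n * p)"
  using assms by (simp add: bcirc_def Let_def carrier_tensorD)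

lemma bcirc_index:
  assumes "A \<in> carrier_tensor m n p" "r < p" "s < p" "i < m" "j < n"
  shows "bcirc A $$ (r * m + i, s * n + j) = A ! ((r + p - s) mod p) $$ (i, j)"
proof -
  have "r * m + i < Suc r * m" "s * n + j < Suc s * n" using assms by auto
  moreover have "Suc r * m \<le> p * m" "Suc s * n \<le> p * n"
    using assms by (intro mult_le_mono; simp)+
  ultimately have "r * m + i < m * p" "s * n + j < n * p"
    by (metis less_le_trans mult.commute)+
  then show ?thesis
    using assms by (simp add: bcirc_def Let_def carrier_tensorD[OF assms(1)])
qed

lemma bcirc_inj:
  assumes "A \<in> carrier_tensor m n p" "B \<in> carrier_tensor m n p" "bcirc A = bcirc B"
  shows "A = B"
proof (rule tensor_eqI[OF assms(1,2)])
  fix k i j assume *: "k < p" "i < m" "j < n"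
  then have "0 < p" by simp
  from bcirc_index[OF assms(1) *(1) this *(2,3)] bcirc_index[OF assms(2) *(1) this *(2,3)]
  show "A ! k $$ (i, j) = B ! k $$ (i, j)" using * assms(3) by simp
qed

lemma sum_blocks:
  fixes f :: "nat \<Rightarrow> 'a::comm_monoid_add"
  shows "(\<Sum>l = 0..<n * p. f l) = (\<Sum>t<p. \<Sum>c<n. f (t * n + c))"
proof -
  have "(\<Sum>l = 0..<n * p. f l) = (\<Sum>t<p. sum f {t * n..<t * n + n})"
    by (simp add: sum.nat_group atLeast0LessThan mult.commute)
  also have "\<dots> = (\<Sum>t<p. \<Sum>c<n. f (t * n + c))"
  proof (rule sum.cong[OF refl])
    fix t
    show "sum f {t * n..<t * n + n} = (\<Sum>c<n. f (t * n + c))"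
      by (rule sum.reindex_bij_witness[of _ "\<lambda>c. t * n + c" "\<lambda>l. l - t * n"]) auto
  qed
  finally show ?thesis .
qed

lemma mod_rotate:
  fixes s t p :: nat
  assumes "t < p" "s < p"
  shows "((t + s) mod p + (p - s)) mod p = t"
proof -
  have "((t + s) mod p + (p - s)) mod p = (t + s + (p - s)) mod p" by (rule mod_add_left_eq)
  also have "t + s + (p - s) = t + p" using assms by simp
  finally show ?thesis using assms by simp
qed

lemma sum_rotate:
  fixes f :: "nat \<Rightarrow> 'a::comm_monoid_add"
  assumes "s < p"
  shows "(\<Sum>t<p. f t) = (\<Sum>t<p. f ((t + s) mod p))"
proof (rule sum.reindex_bij_witness[of _ "\<lambda>t. (t + s) mod p" "\<lambda>t. (t + (p - s)) mod p"])
  fix t assume "t \<in> {..<p}"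
  then have t: "t < p" by simp
  show *: "((t + (p - s)) mod p + s) mod p = t" using t assms by (simp add: mod_simps)
  show "((t + s) mod p + (p - s)) mod p = t" using t assms by (rule mod_rotate)
  show "f (((t + (p - s)) mod p + s) mod p) = f t" by (simp add: *)
qed (use assms in auto)

lemma bcirc_mult_index:
  fixes A B :: "'a::semiring_0 tensor"
  assumes A: "A \<in> carrier_tensor m n p" and B: "B \<in> carrier_tensor n q p"
    and "r < p" "s < p" "i < m" "j < q"
  shows "(bcirc A * bcirc B) $$ (r * m + i, s * q + j) =
    (\<Sum>t<p. \<Sum>c<n. A ! (((r + p - s) mod p + p - t) mod p) $$ (i, c) * B ! t $$ (c, j))"
proof -
  have p: "0 < p" using assms by simp
  note cA = bcirc_carrier[OF A p] and cB = bcirc_carrier[OF B p]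
  have "r * m + i < Suc r * m" "s * q + j < Suc s * q" using assms by auto
  moreover have "Suc r * m \<le> p * m" "Suc s * q \<le> p * q"
    using assms by (intro mult_le_mono; simp)+
  ultimately have I: "r * m + i < m * p" "s * q + j < q * p"
    by (metis less_le_trans mult.commute)+
  have "(bcirc A * bcirc B) $$ (r * m + i, s * q + j) =
      (\<Sum>l = 0..<n * p. bcirc A $$ (r * m + i, l) * bcirc B $$ (l, s * q + j))"
    using cA cB I by (simp add: scalar_prod_def)
  also have "\<dots> = (\<Sum>t<p. \<Sum>c<n. bcirc A $$ (r * m + i, t * n + c) * bcirc B $$ (t * n + c, s * q + j))"
    by (rule sum_blocks)
  also have "\<dots> = (\<Sum>t<p. \<Sum>c<n. A ! ((r + p - t) mod p) $$ (i, c) * B ! ((t + p - s) mod p) $$ (c, j))"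
    using assms by (intro sum.cong refl) (simp add: bcirc_index[OF A] bcirc_index[OF B])
  also have "\<dots> = (\<Sum>t<p. \<Sum>c<n. A ! ((r + p - (t + s) mod p) mod p) $$ (i, c) *
      B ! (((t + s) mod p + p - s) mod p) $$ (c, j))"
    by (rule sum_rotate[OF \<open>s < p\<close>])
  also have "\<dots> = (\<Sum>t<p. \<Sum>c<n. A ! (((r + p - s) mod p + p - t) mod p) $$ (i, c) * B ! t $$ (c, j))"
  proof (intro sum.cong refl)
    fix t assume "t \<in> {..<p}"
    then have t: "t < p" by simp
    have "((t + s) mod p + p - s) mod p = ((t + s) mod p + (p - s)) mod p" using assms by simp
    also have "\<dots> = t" using t \<open>s < p\<close> by (rule mod_rotate)
    finally have 1: "((t + s) mod p + p - s) mod p = t" .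
    have le: "(t + s) mod p \<le> r + p"
      using mod_less_divisor[OF p, of "t + s"] by linarith
    have "int ((r + p - (t + s) mod p) mod p) = (int r + int p - int (t + s) mod int p) mod int p"
      using le by (simp add: of_nat_mod of_nat_diff)
    also have "\<dots> = (int r + int p - int s + int p - int t) mod int p"
    proof -
      have "(int r + int p - int (t + s) mod int p) mod int p = (int r + int p - int (t + s)) mod int p"
        by (rule mod_diff_right_eq)
      also have "\<dots> = (int r + int p - int (t + s) + int p) mod int p"
        by (rule mod_add_self2[symmetric])
      also have "int r + int p - int (t + s) + int p = int r + int p - int s + int p - int t" by simp
      finally show ?thesis .
    qed
    also have "\<dots> = ((int r + int p - int s) mod int p + int p - int t) mod int p"
    proof -
      have "((int r + int p - int s) mod int p + int p - int t) mod int p =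
          ((int r + int p - int s) mod int p + (int p - int t)) mod int p" by (simp add: algebra_simps)
      also have "\<dots> = (int r + int p - int s + (int p - int t)) mod int p" by (rule mod_add_left_eq)
      finally show ?thesis by (simp add: algebra_simps)
    qed
    also have "\<dots> = int (((r + p - s) mod p + p - t) mod p)"
      using t assms by (simp add: of_nat_mod of_nat_diff)
    finally have 2: "(r + p - (t + s) mod p) mod p = ((r + p - s) mod p + p - t) mod p"
      by (simp only: of_nat_eq_iff)
    fix c
    show "A ! ((r + p - (t + s) mod p) mod p) $$ (i, c) * B ! (((t + s) mod p + p - s) mod p) $$ (c, j) =
      A ! (((r + p - s) mod p + p - t) mod p) $$ (i, c) * B ! t $$ (c, j)"
      by (simp only: 1 2)
  qed
  finally show ?thesis .
qed

lemma t_prod_carrier: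
  assumes "A \<in> carrier_tensor m n p" "B \<in> carrier_tensor n q p"
  shows "A *\<^sub>T B \<in> carrier_tensor m q p"
  using assms by (intro carrier_tensorI) (auto simp: t_prod_def carrier_tensorD)

lemma t_prod_index:
  fixes A B :: "'a::semiring_0 tensor"
  assumes A: "A \<in> carrier_tensor m n p" and B: "B \<in> carrier_tensor n q p"
    and "k < p" "i < m" "j < q"
  shows "(A *\<^sub>T B) ! k $$ (i, j) =
    (\<Sum>t<p. \<Sum>c<n. A ! ((k + p - t) mod p) $$ (i, c) * B ! t $$ (c, j))"
proof -
  have "(A *\<^sub>T B) ! k $$ (i, j) = (bcirc A * bcirc B) $$ (k * m + i, 0 * q + j)"
    using assms by (simp add: t_prod_def carrier_tensorD[OF A] carrier_tensorD[OF B])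
  also have "\<dots> = (\<Sum>t<p. \<Sum>c<n. A ! (((k + p - 0) mod p + p - t) mod p) $$ (i, c) * B ! t $$ (c, j))"
    using assms by (intro bcirc_mult_index[OF A B]) auto
  finally show ?thesis using assms by simp
qed

lemma bcirc_t_prod:
  fixes A B :: "'a::semiring_0 tensor"
  assumes A: "A \<in> carrier_tensor m n p" and B: "B \<in> carrier_tensor n q p" and p: "0 < p"
  shows "bcirc (A *\<^sub>T B) = bcirc A * bcirc B"
proof (rule eq_matI)
  note C = t_prod_carrier[OF A B]
  note car = bcirc_carrier[OF A p] bcirc_carrier[OF B p] bcirc_carrier[OF C p]
  show "dim_row (bcirc (A *\<^sub>T B)) = dim_row (bcirc A * bcirc B)"
    "dim_col (bcirc (A *\<^sub>T B)) = dim_col (bcirc A * bcirc B)" using car by auto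
  fix I J assume "I < dim_row (bcirc A * bcirc B)" "J < dim_col (bcirc A * bcirc B)"
  then have IJ: "I < m * p" "J < q * p" using car by auto
  then have mq: "0 < m" "0 < q" by (auto intro: Nat.gr0I)
  have r: "I div m < p" "I mod m < m" "J div q < p" "J mod q < q"
    using IJ mq by (auto simp: less_mult_imp_div_less mult.commute)
  have "bcirc (A *\<^sub>T B) $$ (I div m * m + I mod m, J div q * q + J mod q) =
      (bcirc A * bcirc B) $$ (I div m * m + I mod m, J div q * q + J mod q)"
    using r p by (simp only: bcirc_index[OF C] bcirc_mult_index[OF A B] t_prod_index[OF A B]
        mod_less_divisor)
  then show "bcirc (A *\<^sub>T B) $$ (I, J) = (bcirc A * bcirc B) $$ (I, J)" by simp
qed

lemma t_prod_unique:
  fixes A B :: "'a::semiring_0 tensor"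
  assumes "A \<in> carrier_tensor m n p" "B \<in> carrier_tensor n q p" "0 < p"
    and "C \<in> carrier_tensor m q p"
  shows "bcirc C = bcirc A * bcirc B \<longleftrightarrow> C = A *\<^sub>T B"
  using bcirc_t_prod[OF assms(1-3)] bcirc_inj[OF assms(4) t_prod_carrier[OF assms(1,2)]] by auto

lemma t_one_carrier: "t_one m p \<in> carrier_tensor m m p"
  by (intro carrier_tensorI) (auto simp: t_one_def)

lemma t_pow_carrier:
  assumes "A \<in> carrier_tensor m m p" "0 < p"
  shows "t_pow A k \<in> carrier_tensor m m p"
proof (induction k)
  case 0
  show ?case using assms t_one_carrier by (simp add: carrier_tensorD)
next
  case (Suc k)
  then show ?case using assms(1) by (simp add: t_prod_carrier)
qed

lemma t_exp_carrier:
  assumes "A \<in> carrier_tensor m m p" "0 < p"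
  shows "t_exp A \<in> carrier_tensor m m p"
  using assms by (intro carrier_tensorI) (auto simp: t_exp_def carrier_tensorD)

lemma t_exp_abs_summable:
  fixes A :: "complex tensor"
  assumes A: "A \<in> carrier_tensor m m p" and sij: "s < p" "i < m" "j < m"
  shows "summable (\<lambda>k. norm (1 / fact k * (t_pow A k ! s) $$ (i, j)))"
proof -
  have p: "0 < p" using sij by simp
  define M where "M = (\<Sum>s<p. \<Sum>i<m. \<Sum>j<m. norm (A ! s $$ (i, j)))"
  have M: "norm (A ! s $$ (i, j)) \<le> M" if "s < p" "i < m" "j < m" for s i j
  proof -
    have "norm (A ! s $$ (i, j)) \<le> (\<Sum>j<m. norm (A ! s $$ (i, j)))"
      using that by (intro member_le_sum) auto
    also have "\<dots> \<le> (\<Sum>i<m. \<Sum>j<m. norm (A ! s $$ (i, j)))"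
      using that by (intro member_le_sum[of i _ "\<lambda>i. \<Sum>j<m. norm (A ! s $$ (i, j))"] sum_nonneg) auto
    also have "\<dots> \<le> M" unfolding M_def
      using that
      by (intro member_le_sum[of s _ "\<lambda>s. \<Sum>i<m. \<Sum>j<m. norm (A ! s $$ (i, j))"] sum_nonneg) auto
    finally show ?thesis .
  qed
  have M0: "0 \<le> M" unfolding M_def by (intro sum_nonneg) simp
  define K where "K = real p * real m * M"
  have K0: "0 \<le> K" using M0 by (simp add: K_def)
  have bound: "norm (t_pow A k ! s $$ (i, j)) \<le> K ^ k" if "s < p" "i < m" "j < m" for k s i j
    using that
  proof (induction k arbitrary: s i j)
    case 0
    then show ?case using A p by (auto simp: t_one_def carrier_tensorD[OF A])
  next
    case (Suc k)
    note P = t_pow_carrier[OF A p, of k]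
    have "norm (t_pow A (Suc k) ! s $$ (i, j)) \<le>
        (\<Sum>t<p. \<Sum>c<m. norm (t_pow A k ! ((s + p - t) mod p) $$ (i, c) * A ! t $$ (c, j)))"
      using Suc.prems by (auto simp: t_prod_index[OF P A] intro!: sum_norm_le)
    also have "\<dots> \<le> (\<Sum>t<p. \<Sum>c<m. K ^ k * M)"
      using Suc p K0 by (intro sum_mono) (auto simp: norm_mult intro!: mult_mono M)
    also have "\<dots> = K ^ Suc k" by (simp add: K_def)
    finally show ?case .
  qed
  show ?thesis
  proof (rule summable_comparison_test')
    show "summable (\<lambda>k. inverse (fact k) * K ^ k)" by (rule summable_exp)
    show "norm (norm (1 / fact k * (t_pow A k ! s) $$ (i, j))) \<le> inverse (fact k) * K ^ k" if "k \<ge> 0" for k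
      using bound[OF sij, of k] by (simp add: norm_mult norm_divide divide_simps)
  qed
qed

lemma root_unity_sum:
  assumes "j < p" "k < p"
  shows "(\<Sum>i<p. root_unity p ^ (i * j) * inverse (root_unity p) ^ (i * k)) = (if j = k then of_nat p else 0)"
proof -
  have p: "0 < p" using assms by simp
  let ?w = "root_unity p"
  define z where "z = ?w ^ j / ?w ^ k"
  have w0: "?w \<noteq> 0" by (simp add: root_unity_def)
  have cis: "?w ^ l = cis (2 * pi * real l / real p)" for l
  proof -
    have "?w = cis (2 * pi / real p)" by (simp add: root_unity_def cis_conv_exp mult_ac)
    then show ?thesis by (simp add: DeMoivre mult_ac)
  qed
  have wp: "?w ^ p = 1" using p by (simp add: cis)
  have summand: "?w ^ (i * j) * inverse ?w ^ (i * k) = z ^ i" for i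
    by (simp add: z_def divide_inverse power_mult_distrib power_inverse power_mult[symmetric] mult.commute[of i])
  have "(?w ^ l) ^ p = 1" for l
    using wp by (metis power_mult mult.commute power_one)
  then have zp: "z ^ p = 1" by (simp add: z_def power_divide)
  show ?thesis
  proof (cases "j = k")
    case True
    then have "z = 1" using w0 by (simp add: z_def)
    then have "(\<Sum>i<p. ?w ^ (i * j) * inverse ?w ^ (i * k)) = of_nat p"
      unfolding summand by simp
    then show ?thesis using True by simp
  next
    case False
    have "inj_on (\<lambda>l. cis (2 * pi * real l / real p)) {..<p}"
      using bij_betw_roots_unity[OF p] by (simp add: bij_betw_def)
    then have "?w ^ j \<noteq> ?w ^ k" using assms False by (auto simp: cis inj_on_def)
    then have "z \<noteq> 1" using w0 by (simp add: z_def)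
    then show ?thesis using False by (simp only: summand) (simp add: sum_gp_strict zp)
  qed
qed

lemma fourier_slice_inj:
  assumes A: "A \<in> carrier_tensor m n p" and B: "B \<in> carrier_tensor m n p"
    and eq: "\<And>i. i < p \<Longrightarrow> fourier_slice A i = fourier_slice B i"
  shows "A = B"
proof (rule tensor_eqI[OF A B])
  fix k r c assume k: "k < p" and rc: "r < m" "c < n"
  then have p: "0 < p" by simp
  let ?w = "root_unity p"
  have inv: "(\<Sum>i<p. inverse ?w ^ (i * k) * fourier_slice T i $$ (r, c)) = of_nat p * T ! k $$ (r, c)"
    if T: "T \<in> carrier_tensor m n p" for T
  proof -
    have "(\<Sum>i<p. inverse ?w ^ (i * k) * fourier_slice T i $$ (r, c)) =
        (\<Sum>i<p. \<Sum>j<p. T ! j $$ (r, c) * (?w ^ (i * j) * inverse ?w ^ (i * k)))"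
      using rc p by (simp add: fourier_slice_def carrier_tensorD[OF T] sum_distrib_left mult_ac)
    also have "\<dots> = (\<Sum>j<p. T ! j $$ (r, c) * (\<Sum>i<p. ?w ^ (i * j) * inverse ?w ^ (i * k)))"
      by (subst sum.swap) (simp add: sum_distrib_left)
    also have "\<dots> = (\<Sum>j<p. T ! j $$ (r, c) * (if j = k then of_nat p else 0))"
      using k by (intro sum.cong refl) (simp only: root_unity_sum lessThan_iff)
    also have "\<dots> = (\<Sum>j<p. if j = k then T ! j $$ (r, c) * of_nat p else 0)"
      by (intro sum.cong refl) simp
    also have "\<dots> = of_nat p * T ! k $$ (r, c)"
      using k by (simp add: mult.commute)
    finally show ?thesis .
  qed
  have "of_nat p * A ! k $$ (r, c) = of_nat p * B ! k $$ (r, c)"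
    using eq by (simp flip: inv[OF A] inv[OF B])
  then show "A ! k $$ (r, c) = B ! k $$ (r, c)" using p by simp
qed

lemma J_mat_carrier: "J_mat n \<in> carrier_mat (2 * n) (2 * n)"
  unfolding J_mat_def mult_2 by (intro four_block_carrier_mat) auto

lemma t_J_unique:
  assumes p: "0 < p"
  shows "A \<in> carrier_tensor (2 * n) (2 * n) p \<and> (\<forall>i<p. fourier_slice A i = J_mat n) \<longleftrightarrow>
    A = map (\<lambda>k. if k = 0 then J_mat n else 0\<^sub>m (2 * n) (2 * n)) [0..<p]" (is "_ \<longleftrightarrow> A = ?J")
proof -
  have J: "?J \<in> carrier_tensor (2 * n) (2 * n) p"
    using J_mat_carrier by (intro carrier_tensorI) auto
  have F: "fourier_slice ?J i = J_mat n" if "i < p" for i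
  proof (rule eq_matI)
    show "dim_row (fourier_slice ?J i) = dim_row (J_mat n)" "dim_col (fourier_slice ?J i) = dim_col (J_mat n)"
      using J_mat_carrier[of n] carrier_tensorD[OF J] p by (auto simp: fourier_slice_def)
    fix r c assume "r < dim_row (J_mat n)" "c < dim_col (J_mat n)"
    then have rc: "r < 2 * n" "c < 2 * n" using J_mat_carrier[of n] by auto
    have "fourier_slice ?J i $$ (r, c) = (\<Sum>j<p. root_unity p ^ (i * j) * ?J ! j $$ (r, c))"
      using rc p by (simp add: fourier_slice_def carrier_tensorD[OF J] del: upt_Suc)
    also have "\<dots> = (\<Sum>j<p. if j = 0 then J_mat n $$ (r, c) else 0)"
      using rc by (intro sum.cong refl) auto
    also have "\<dots> = J_mat n $$ (r, c)" using p by simp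
    finally show "fourier_slice ?J i $$ (r, c) = J_mat n $$ (r, c)" .
  qed
  show ?thesis
  proof
    assume "A \<in> carrier_tensor (2 * n) (2 * n) p \<and> (\<forall>i<p. fourier_slice A i = J_mat n)"
    then show "A = ?J" by (intro fourier_slice_inj[OF _ J]) (simp_all only: F)
  next
    assume "A = ?J"
    then show "A \<in> carrier_tensor (2 * n) (2 * n) p \<and> (\<forall>i<p. fourier_slice A i = J_mat n)"
      using J F by (simp only:) blast
  qed
qed

lemma t_J_eq:
  assumes "0 < p"
  shows "t_J n p = map (\<lambda>k. if k = 0 then J_mat n else 0\<^sub>m (2 * n) (2 * n)) [0..<p]"
  unfolding t_J_def t_J_unique[OF assms] by simp

end

theory Submission
  imports Defs
begin

text \<open>
  Block circulant embedding \<open>bcirc\<close> turns T-products, T-adjoints and the T-exponential into the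
  corresponding operations on matrices. With \<open>K = bcirc \<J>\<close>, which is skew-Hermitian, and
  \<open>B = bcirc \<H>\<close>, the T-Hamiltonian condition says \<open>B\<^sup>H K = K (- B)\<close>. Hence \<open>K\<close> intertwines all
  powers of \<open>B\<^sup>H\<close> and \<open>- B\<close>, so \<open>(exp B)\<^sup>H K (exp B) = K (exp (- B)) (exp B) = K\<close>.
\<close>

section \<open>Matrix adjoints and powers\<close>

lemma mat_adjoint_carrier:
  assumes "A \<in> carrier_mat m n"
  shows "mat_adjoint A \<in> carrier_mat n m"
  using assms by (auto simp: mat_adjoint_def mat_of_rows_def)

lemma mat_adjoint_index:
  fixes A :: "complex mat"
  assumes "A \<in> carrier_mat m n" "i < n" "j < m"
  shows "mat_adjoint A $$ (i, j) = cnj (A $$ (j, i))"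
  using assms by (simp add: mat_adjoint_def mat_of_rows_def conjugate_vec_def)

lemma mat_adjoint_mult:
  fixes A B :: "complex mat"
  assumes A: "A \<in> carrier_mat l m" and B: "B \<in> carrier_mat m n"
  shows "mat_adjoint (A * B) = mat_adjoint B * mat_adjoint A"
proof -
  note car = mat_adjoint_carrier[OF A] mat_adjoint_carrier[OF B] mult_carrier_mat[OF A B]
  show ?thesis
  proof (rule eq_matI)
    fix i j assume "i < dim_row (mat_adjoint B * mat_adjoint A)" "j < dim_col (mat_adjoint B * mat_adjoint A)"
    then have "i < n" "j < l" using car by auto
    then show "mat_adjoint (A * B) $$ (i, j) = (mat_adjoint B * mat_adjoint A) $$ (i, j)"
      using A B car by (simp add: mat_adjoint_index[OF mult_carrier_mat[OF A B]] scalar_prod_def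
          mat_adjoint_index[OF A] mat_adjoint_index[OF B] mult.commute)
  qed (use car mat_adjoint_carrier[OF car(3)] in auto)
qed

text \<open>Each factor \<open>A\<close> becomes a factor \<open>C\<close> as it passes
  \<open>K\<close>, so induction moves them across one by one. The case where all three matrices
  coincide gives the commutation of a matrix with its own powers.\<close>

lemma pow_mat_intertwine:
  fixes A :: "'a::semiring_1 mat"
  assumes A: "A \<in> carrier_mat n n" and C: "C \<in> carrier_mat m m" and K: "K \<in> carrier_mat n m"
    and AK: "A * K = K * C"
  shows "A ^\<^sub>m k * K = K * C ^\<^sub>m k"
proof (induction k)
  case 0
  show ?case using A C K by simp
next
  case (Suc k)
  have Ak: "A ^\<^sub>m k \<in> carrier_mat n n" and Ck: "C ^\<^sub>m k \<in> carrier_mat m m"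
    using A C by auto
  have "A ^\<^sub>m Suc k * K = A ^\<^sub>m k * (K * C)"
    using assoc_mult_mat[OF Ak A K] AK by simp
  also have "\<dots> = K * C ^\<^sub>m k * C"
    using assoc_mult_mat[OF Ak K C] Suc by simp
  also have "\<dots> = K * C ^\<^sub>m Suc k"
    using assoc_mult_mat[OF K Ck C] by simp
  finally show ?case .
qed

lemma pow_mat_commute:
  assumes "A \<in> carrier_mat n n"
  shows "A ^\<^sub>m k * A = A * A ^\<^sub>m k"
  by (rule pow_mat_intertwine[OF assms assms assms refl])

lemma pow_mat_add:
  assumes A: "A \<in> carrier_mat n n"
  shows "A ^\<^sub>m (k + l) = A ^\<^sub>m k * A ^\<^sub>m l"
proof (induction l)
  case 0
  show ?case using pow_carrier_mat[OF A, of k] A by simp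
next
  case (Suc l)
  then show ?case
    using assoc_mult_mat[OF pow_carrier_mat[OF A] pow_carrier_mat[OF A] A, of k l] by simp
qed

lemma mat_adjoint_pow:
  fixes A :: "complex mat"
  assumes A: "A \<in> carrier_mat n n"
  shows "mat_adjoint (A ^\<^sub>m k) = mat_adjoint A ^\<^sub>m k"
proof (induction k)
  case 0
  show ?case
    using A mat_adjoint_carrier[OF A] mat_adjoint_carrier[of "1\<^sub>m n :: complex mat" n n]
    by (intro eq_matI) (auto simp: mat_adjoint_index[of _ n n])
next
  case (Suc k)
  have "mat_adjoint (A ^\<^sub>m Suc k) = mat_adjoint A * mat_adjoint A ^\<^sub>m k"
    using mat_adjoint_mult[OF pow_carrier_mat[OF A] A] Suc by simp
  also have "\<dots> = mat_adjoint A ^\<^sub>m Suc k"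
    using pow_mat_commute[OF mat_adjoint_carrier[OF A]] by simp
  finally show ?case .
qed

text \<open>Stated for entries because the exponential is summed entrywise: the sign then leaves the
  matrix power as a scalar coefficient of the series.\<close>

lemma uminus_pow_mat_index:
  fixes A :: "'a::comm_ring_1 mat"
  assumes A: "A \<in> carrier_mat n n" and "i < n" "j < n"
  shows "((- A) ^\<^sub>m k) $$ (i, j) = (- 1) ^ k * (A ^\<^sub>m k) $$ (i, j)"
  using assms(2-)
proof (induction k arbitrary: i j)
  case 0
  then show ?case using A by simp
next
  case (Suc k)
  have "- A \<in> carrier_mat n n" using A by simp
  note D = A this pow_carrier_mat[OF A, of k] pow_carrier_mat[OF this, of k]
  have "((- A) ^\<^sub>m Suc k) $$ (i, j) = (\<Sum>c<n. ((- A) ^\<^sub>m k) $$ (i, c) * (- A) $$ (c, j))"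
    using D Suc.prems by (simp add: scalar_prod_def atLeast0LessThan flip: sum_negf)
  also have "\<dots> = (\<Sum>c<n. (- 1) ^ Suc k * ((A ^\<^sub>m k) $$ (i, c) * A $$ (c, j)))"
    using A Suc by (intro sum.cong) auto
  also have "\<dots> = (- 1) ^ Suc k * (A ^\<^sub>m Suc k) $$ (i, j)"
    using D Suc.prems by (simp add: scalar_prod_def atLeast0LessThan sum_distrib_left)
  finally show ?case .
qed


section \<open>The matrix exponential\<close>

text \<open>The same entrywise series as in \<open>t_exp\<close>, so that the two exponentials can
  be compared term by term through \<open>bcirc\<close>.\<close>

definition mat_exp :: "complex mat \<Rightarrow> complex mat" where
  "mat_exp A = mat (dim_row A) (dim_row A) (\<lambda>(i, j). \<Sum>k. 1 / fact k * (A ^\<^sub>m k) $$ (i, j))"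

lemma mat_exp_carrier:
  assumes "A \<in> carrier_mat n n"
  shows "mat_exp A \<in> carrier_mat n n"
  using assms by (auto simp: mat_exp_def)

lemma bcirc_singleton: "bcirc [A] = A"
  by (intro eq_matI) (auto simp: bcirc_def t_rows_def t_cols_def Let_def)

text \<open>A matrix is a tensor with one slice, on which the T-product is the matrix product.
  Through this case the absolute convergence proved for the tensor series carries over to
  \<open>mat_exp\<close>.\<close>

lemma t_pow_singleton:
  fixes A :: "'a::semiring_1 mat"
  assumes A: "A \<in> carrier_mat n n"
  shows "t_pow [A] k = [A ^\<^sub>m k]"
proof (induction k)
  case 0
  show ?case by (simp add: t_one_def t_rows_def)
next
  case (Suc k)
  have "[B] \<in> carrier_tensor n n 1" if "B \<in> carrier_mat n n" for B :: "'a mat"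
    using that by (simp add: carrier_tensor_def)
  note T = this[OF pow_carrier_mat[OF A, of k]] this[OF A] less_numeral_extra(1)
    this[OF pow_carrier_mat[OF A, of "Suc k"]]
  \<comment> \<open>With \<open>p = 1\<close>, \<open>t_prod_unique\<close> turns this into an
    equation of \<open>bcirc\<close> matrices, which are the slices themselves.\<close>
  have "[A ^\<^sub>m Suc k] = [A ^\<^sub>m k] *\<^sub>T [A]"
    by (subst t_prod_unique[OF T, symmetric]) (simp add: bcirc_singleton)
  then show ?case using Suc by simp
qed

lemma mat_exp_abs_summable:
  fixes A :: "complex mat"
  assumes A: "A \<in> carrier_mat n n" and "i < n" "j < n"
  shows "summable (\<lambda>k. norm (1 / fact k * (A ^\<^sub>m k) $$ (i, j)))"
  using t_exp_abs_summable[where A = "[A]" and m = n and p = 1 and s = 0] assms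
  by (simp add: t_pow_singleton[OF A] carrier_tensor_def)

lemma mat_exp_sums:
  assumes A: "A \<in> carrier_mat n n" and "i < n" "j < n"
  shows "(\<lambda>k. 1 / fact k * (A ^\<^sub>m k) $$ (i, j)) sums mat_exp A $$ (i, j)"
  using summable_norm_cancel[OF mat_exp_abs_summable[OF assms]] assms
  by (simp add: mat_exp_def summable_sums)

text \<open>Multiplying by \<open>K\<close> forms finite linear combinations of entries, so it
  passes through the series. The two resulting series agree term by term by
  \<open>pow_mat_intertwine\<close>.\<close>

lemma mat_exp_intertwine:
  assumes A: "A \<in> carrier_mat n n" and C: "C \<in> carrier_mat m m" and K: "K \<in> carrier_mat n m"
    and AK: "A * K = K * C"
  shows "mat_exp A * K = K * mat_exp C"
proof (rule eq_matI)
  note D = mat_exp_carrier[OF A] mat_exp_carrier[OF C] A C K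
  fix i j assume "i < dim_row (K * mat_exp C)" "j < dim_col (K * mat_exp C)"
  then have ij: "i < n" "j < m" using D by auto
  have "(\<lambda>k. \<Sum>c<n. 1 / fact k * (A ^\<^sub>m k) $$ (i, c) * K $$ (c, j)) sums
      (\<Sum>c<n. mat_exp A $$ (i, c) * K $$ (c, j))"
    using ij by (intro sums_sum sums_mult2 mat_exp_sums[OF A]) auto
  then have 1: "(\<lambda>k. 1 / fact k * (A ^\<^sub>m k * K) $$ (i, j)) sums (mat_exp A * K) $$ (i, j)"
    using ij D by (simp add: scalar_prod_def atLeast0LessThan sum_distrib_left mult.assoc)
  have "(\<lambda>k. \<Sum>c<m. K $$ (i, c) * (1 / fact k * (C ^\<^sub>m k) $$ (c, j))) sums
      (\<Sum>c<m. K $$ (i, c) * mat_exp C $$ (c, j))"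
    using ij by (intro sums_sum sums_mult mat_exp_sums[OF C]) auto
  then have 2: "(\<lambda>k. 1 / fact k * (K * C ^\<^sub>m k) $$ (i, j)) sums (K * mat_exp C) $$ (i, j)"
    using ij D by (simp add: scalar_prod_def atLeast0LessThan sum_distrib_left mult_ac)
  show "(mat_exp A * K) $$ (i, j) = (K * mat_exp C) $$ (i, j)"
    using 1 2 unfolding pow_mat_intertwine[OF A C K AK] by (rule sums_unique2)
qed (use mat_exp_carrier[OF A] mat_exp_carrier[OF C] K in auto)

text \<open>Complex conjugation passes through the convergent entry series, whose coefficients
  \<open>1 / fact k\<close> are real.\<close>

lemma mat_adjoint_exp:
  assumes A: "A \<in> carrier_mat n n"
  shows "mat_adjoint (mat_exp A) = mat_exp (mat_adjoint A)"
proof -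
  note A' = mat_adjoint_carrier[OF A]
  note D = mat_exp_carrier[OF A] mat_exp_carrier[OF A'] mat_adjoint_carrier[OF mat_exp_carrier[OF A]]
  show ?thesis
  proof (rule eq_matI)
    fix i j assume "i < dim_row (mat_exp (mat_adjoint A))" "j < dim_col (mat_exp (mat_adjoint A))"
    then have ij: "i < n" "j < n" using D by auto
    have "(\<lambda>k. cnj (1 / fact k * (A ^\<^sub>m k) $$ (j, i))) sums cnj (mat_exp A $$ (j, i))"
      using mat_exp_sums[OF A ij(2,1)] by (simp only: sums_cnj)
    moreover have "cnj (1 / fact k * (A ^\<^sub>m k) $$ (j, i)) = 1 / fact k * (mat_adjoint A ^\<^sub>m k) $$ (i, j)" for k
      by (simp add: mat_adjoint_pow[OF A, symmetric] mat_adjoint_index[OF pow_carrier_mat[OF A] ij])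
    ultimately show "mat_adjoint (mat_exp A) $$ (i, j) = mat_exp (mat_adjoint A) $$ (i, j)"
      using mat_exp_sums[OF A' ij] by (simp add: mat_adjoint_index[OF D(1) ij] sums_unique2)
  qed (use D in auto)
qed

text \<open>Absolute convergence permits Cauchy products of the entry series. The term of order
  \<open>k\<close> is \<open>(- 1 + 1) ^ k / fact k\<close> times the \<open>k\<close>-th power of
  \<open>A\<close>, so only \<open>k = 0\<close> survives.\<close>

lemma mat_exp_uminus_mult:
  assumes A: "A \<in> carrier_mat n n"
  shows "mat_exp (- A) * mat_exp A = 1\<^sub>m n"
proof -
  have A': "- A \<in> carrier_mat n n" using A by simp
  note D = mat_exp_carrier[OF A] mat_exp_carrier[OF A']
  let ?f = "\<lambda>A i j k. 1 / fact k * (A ^\<^sub>m k) $$ (i, j) :: complex"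
  have entry: "(\<Sum>c<n. \<Sum>l\<le>k. ?f (- A) i c l * ?f A c j (k - l)) = (if k = 0 then 1\<^sub>m n $$ (i, j) else 0)"
    if ij: "i < n" "j < n" for i j k
  proof -
    \<comment> \<open>Summing over \<open>c\<close> first produces an entry of a product of two
      powers of \<open>A\<close>, while the signs join the scalar coefficients.\<close>
    have "(\<Sum>c<n. \<Sum>l\<le>k. ?f (- A) i c l * ?f A c j (k - l)) =
        (\<Sum>l\<le>k. (- 1) ^ l / fact l * (1 / fact (k - l)) *
          (\<Sum>c<n. (A ^\<^sub>m l) $$ (i, c) * (A ^\<^sub>m (k - l)) $$ (c, j)))"
      using ij by (subst sum.swap)
        (auto simp: uminus_pow_mat_index[OF A] sum_distrib_left mult_ac intro!: sum.cong)
    also have "\<dots> = (\<Sum>l\<le>k. (- 1) ^ l / fact l * (1 / fact (k - l)) * (A ^\<^sub>m k) $$ (i, j))"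
    proof (intro sum.cong refl arg_cong2[where f = times])
      fix l assume "l \<in> {..k}"
      then have "A ^\<^sub>m k = A ^\<^sub>m l * A ^\<^sub>m (k - l)" by (simp flip: pow_mat_add[OF A])
      then show "(\<Sum>c<n. (A ^\<^sub>m l) $$ (i, c) * (A ^\<^sub>m (k - l)) $$ (c, j)) = (A ^\<^sub>m k) $$ (i, j)"
        using ij A pow_carrier_mat[OF A, of l] pow_carrier_mat[OF A, of "k - l"]
        by (simp add: scalar_prod_def atLeast0LessThan)
    qed
    \<comment> \<open>The coefficients sum by the binomial theorem, taken from the exponential
      series at the scalars -1 and 1. Here \<open>0 ^ 0 = 1\<close> keeps the constant term.\<close>
    also have "\<dots> = (0 ^ k /\<^sub>R fact k) * (A ^\<^sub>m k) $$ (i, j)"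
      using exp_series_add_commuting[of "- 1 :: complex" 1 k]
      unfolding sum_distrib_right[symmetric]
      by (simp add: scaleR_conv_of_real divide_inverse mult_ac)
    also have "\<dots> = (if k = 0 then 1\<^sub>m n $$ (i, j) else 0)" using A by auto
    finally show ?thesis .
  qed
  show ?thesis
  proof (rule eq_matI)
    fix i j assume "i < dim_row (1\<^sub>m n :: complex mat)" "j < dim_col (1\<^sub>m n :: complex mat)"
    then have ij: "i < n" "j < n" by auto
    have "(\<lambda>k. \<Sum>l\<le>k. ?f (- A) i c l * ?f A c j (k - l)) sums (mat_exp (- A) $$ (i, c) * mat_exp A $$ (c, j))"
      if "c < n" for c
      using Cauchy_product_sums[OF mat_exp_abs_summable[OF A' ij(1) that] mat_exp_abs_summable[OF A that ij(2)]]
      by (simp only: sums_unique[OF mat_exp_sums[OF A' ij(1) that], symmetric]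
          sums_unique[OF mat_exp_sums[OF A that ij(2)], symmetric])
    then have "(\<lambda>k. \<Sum>c<n. \<Sum>l\<le>k. ?f (- A) i c l * ?f A c j (k - l)) sums
        (\<Sum>c<n. mat_exp (- A) $$ (i, c) * mat_exp A $$ (c, j))"
      by (intro sums_sum) simp
    moreover have "(\<lambda>k. if k = 0 then 1\<^sub>m n $$ (i, j) else 0 :: complex) sums 1\<^sub>m n $$ (i, j)"
      by (rule sums_single)
    ultimately have "(\<Sum>c<n. mat_exp (- A) $$ (i, c) * mat_exp A $$ (c, j)) = 1\<^sub>m n $$ (i, j)"
      unfolding entry[OF ij] by (rule sums_unique2)
    then show "(mat_exp (- A) * mat_exp A) $$ (i, j) = 1\<^sub>m n $$ (i, j)"
      using ij D by (simp add: scalar_prod_def atLeast0LessThan)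
  qed (use D in auto)
qed


section \<open>The block circulant embedding\<close>

text \<open>Division with remainder splits each index into a block number and an offset, so equality
  with a block circulant matrix can be checked block by block.\<close>

lemma bcirc_eqI:
  assumes A: "A \<in> carrier_tensor m n p" and p: "0 < p" and M: "M \<in> carrier_mat (m * p) (n * p)"
    and eq: "\<And>r s i j. r < p \<Longrightarrow> s < p \<Longrightarrow> i < m \<Longrightarrow> j < n \<Longrightarrow>
      A ! ((r + p - s) mod p) $$ (i, j) = M $$ (r * m + i, s * n + j)"
  shows "bcirc A = M"
proof (rule eq_matI)
  note C = bcirc_carrier[OF A p]
  fix I J assume "I < dim_row M" "J < dim_col M"
  then have IJ: "I < m * p" "J < n * p" using M by auto
  then have "0 < m" "0 < n" by (auto intro: Nat.gr0I)
  then have r: "I div m < p" "I mod m < m" "J div n < p" "J mod n < n"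
    using IJ by (auto simp: less_mult_imp_div_less mult.commute)
  have "bcirc A $$ (I div m * m + I mod m, J div n * n + J mod n) =
      M $$ (I div m * m + I mod m, J div n * n + J mod n)"
    using eq[OF r(1,3,2,4)] by (simp only: bcirc_index[OF A r(1,3,2,4)])
  then show "bcirc A $$ (I, J) = M $$ (I, J)" by simp
qed (use M bcirc_carrier[OF A p] in auto)

lemma block_index_less:
  fixes r p m i :: nat
  assumes "r < p" "i < m"
  shows "r * m + i < m * p"
proof -
  have "r * m + i < Suc r * m" using assms by simp
  also have "\<dots> \<le> p * m" using assms by (intro mult_le_mono) auto
  finally show ?thesis by (simp add: mult.commute)
qed

lemma bcirc_t_one:
  assumes p: "0 < p"
  shows "bcirc (t_one m p) = 1\<^sub>m (m * p)"
proof (rule bcirc_eqI[OF t_one_carrier p])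
  fix r s i j assume *: "r < p" "s < p" "i < m" "j < m"
  \<comment> \<open>If \<open>s > r\<close>, then \<open>r + p - s\<close> lies strictly between 0
    and \<open>p\<close>, so it is its own nonzero residue.\<close>
  have "(r + p - s) mod p = 0 \<longleftrightarrow> r = s"
  proof (cases "s \<le> r")
    case True
    then have "(r + p - s) mod p = r - s" using * by (simp add: mod_if)
    then show ?thesis using True by auto
  qed (use * in auto)
  moreover have "r * m + i = s * m + j \<longleftrightarrow> r = s \<and> i = j"
    using * by (metis add_left_cancel div_mult_self3 div_less add_0_right
        less_nat_zero_code mult.commute)
  ultimately show "t_one m p ! ((r + p - s) mod p) $$ (i, j) = 1\<^sub>m (m * p) $$ (r * m + i, s * m + j)"
    using * block_index_less[OF *(1,3)] block_index_less[OF *(2,4)] by (auto simp: t_one_def)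
qed simp

lemma bcirc_t_pow:
  assumes A: "A \<in> carrier_tensor m m p" and p: "0 < p"
  shows "bcirc (t_pow A k) = bcirc A ^\<^sub>m k"
proof (induction k)
  case 0
  show ?case using bcirc_carrier[OF A p] p by (simp add: bcirc_t_one carrier_tensorD[OF A])
next
  case (Suc k)
  then show ?case by (simp add: bcirc_t_prod[OF t_pow_carrier[OF A p] A p])
qed

text \<open>By \<open>bcirc_t_pow\<close>, the series for an entry of a slice is the series for
  every entry of the block circulant matrix where that slice entry is placed.\<close>

lemma bcirc_t_exp:
  assumes A: "A \<in> carrier_tensor m m p" and p: "0 < p"
  shows "bcirc (t_exp A) = mat_exp (bcirc A)"
proof (rule bcirc_eqI[OF t_exp_carrier[OF A p] p mat_exp_carrier[OF bcirc_carrier[OF A p]]])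
  fix r s i j assume *: "r < p" "s < p" "i < m" "j < m"
  have "t_exp A ! ((r + p - s) mod p) $$ (i, j) =
      (\<Sum>k. 1 / fact k * (t_pow A k ! ((r + p - s) mod p)) $$ (i, j))"
    using * p by (simp add: t_exp_def carrier_tensorD[OF A])
  also have "\<dots> = (\<Sum>k. 1 / fact k * (bcirc A ^\<^sub>m k) $$ (r * m + i, s * m + j))"
    by (simp add: bcirc_t_pow[OF A p, symmetric] bcirc_index[OF t_pow_carrier[OF A p] *])
  also have "\<dots> = mat_exp (bcirc A) $$ (r * m + i, s * m + j)"
    using block_index_less[OF *(1,3)] block_index_less[OF *(2,4)] bcirc_carrier[OF A p]
    by (simp add: mat_exp_def)
  finally show "t_exp A ! ((r + p - s) mod p) $$ (i, j) = mat_exp (bcirc A) $$ (r * m + i, s * m + j)" .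
qed

text \<open>Reducing modulo \<open>p\<close> merges the special case of slice 0 with the reversal of
  the other slices: the index is negated in the integers modulo \<open>p\<close>.\<close>

lemma t_adjoint_nth:
  assumes A: "A \<in> carrier_tensor m n p" and k: "k < p"
  shows "t_adjoint A ! k = mat_adjoint (A ! ((p - k) mod p))"
  using assms by (auto simp: t_adjoint_def carrier_tensorD[OF A])

lemma t_adjoint_carrier:
  assumes A: "A \<in> carrier_tensor m n p"
  shows "t_adjoint A \<in> carrier_tensor n m p"
proof (rule carrier_tensorI)
  show "length (t_adjoint A) = p" using A by (simp add: t_adjoint_def carrier_tensorD)
  show "t_adjoint A ! k \<in> carrier_mat n m" if "k < p" for k
    using that by (auto simp: t_adjoint_nth[OF A that] intro!: mat_adjoint_carrier carrier_tensorD(2)[OF A])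
qed

text \<open>The adjoint exchanges block row and block column, which replaces \<open>r - s\<close> by
  \<open>s - r\<close> modulo \<open>p\<close>. This is the index negation built into
  \<open>t_adjoint\<close>.\<close>

lemma bcirc_t_adjoint:
  assumes A: "A \<in> carrier_tensor m n p" and p: "0 < p"
  shows "bcirc (t_adjoint A) = mat_adjoint (bcirc A)"
proof (rule bcirc_eqI[OF t_adjoint_carrier[OF A] p mat_adjoint_carrier[OF bcirc_carrier[OF A p]]])
  fix r s i j assume *: "r < p" "s < p" "i < n" "j < m"
  have "(p - (r + p - s) mod p) mod p = (s + p - r) mod p"
  proof (cases "s \<le> r")
    case True
    then have "(r + p - s) mod p = r - s" using * by (simp add: mod_if)
    then show ?thesis using True * by (simp add: algebra_simps)
  next
    case False
    then have "p - (r + p - s) = s - r" "s + p - r = s - r + p" "(r + p - s) mod p = r + p - s"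
      using * by simp_all
    then show ?thesis by (simp only: mod_add_self2)
  qed
  then have "t_adjoint A ! ((r + p - s) mod p) $$ (i, j) = mat_adjoint (A ! ((s + p - r) mod p)) $$ (i, j)"
    using p by (simp add: t_adjoint_nth[OF A])
  also have "\<dots> = cnj (A ! ((s + p - r) mod p) $$ (j, i))"
    using * p by (intro mat_adjoint_index[OF carrier_tensorD(2)[OF A]]) auto
  also have "\<dots> = mat_adjoint (bcirc A) $$ (r * n + i, s * m + j)"
    by (simp add: bcirc_index[OF A *(2,1,4,3)]
        mat_adjoint_index[OF bcirc_carrier[OF A p] block_index_less[OF *(1,3)] block_index_less[OF *(2,4)]])
  finally show "t_adjoint A ! ((r + p - s) mod p) $$ (i, j) =
      mat_adjoint (bcirc A) $$ (r * n + i, s * m + j)" .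
qed

lemma t_J_carrier:
  assumes "0 < p"
  shows "t_J n p \<in> carrier_tensor (2 * n) (2 * n) p"
  using J_mat_carrier by (intro carrier_tensorI) (auto simp: t_J_eq[OF assms])

lemma mat_adjoint_J_mat: "mat_adjoint (J_mat n) = - J_mat n"
proof (rule eq_matI)
  fix i j assume "i < dim_row (- J_mat n)" "j < dim_col (- J_mat n)"
  then have "i < 2 * n" "j < 2 * n" using J_mat_carrier[of n] by auto
  then show "mat_adjoint (J_mat n) $$ (i, j) = (- J_mat n) $$ (i, j)"
    using J_mat_carrier[of n]
    by (simp add: mat_adjoint_index[OF J_mat_carrier]) (auto simp: J_mat_def)
qed (use J_mat_carrier[of n] mat_adjoint_carrier[OF J_mat_carrier[of n]] in auto)

text \<open>Index negation fixes slice 0, the only slice that may be nonzero, and that slice is the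
  real skew-symmetric matrix \<open>J_mat n\<close>.\<close>

lemma mat_adjoint_bcirc_t_J:
  assumes p: "0 < p"
  shows "mat_adjoint (bcirc (t_J n p)) = - bcirc (t_J n p)"
proof -
  note J = t_J_carrier[OF p, of n]
  have "bcirc (t_adjoint (t_J n p)) = - bcirc (t_J n p)"
  proof (rule bcirc_eqI[OF t_adjoint_carrier[OF J] p])
    show "- bcirc (t_J n p) \<in> carrier_mat (2 * n * p) (2 * n * p)"
      using bcirc_carrier[OF J p] by simp
    fix r s i j assume *: "r < p" "s < p" "i < 2 * n" "j < 2 * n"
    have J_nth: "t_J n p ! k = (if k = 0 then J_mat n else 0\<^sub>m (2 * n) (2 * n))" if "k < p" for k
      using that p by (simp add: t_J_eq)
    have slice: "t_adjoint (t_J n p) ! k $$ (i, j) = - (t_J n p ! k $$ (i, j))" if "k < p" for k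
    proof (cases "k = 0")
      case True
      then show ?thesis
        using p * J_mat_carrier[of n]
        by (simp add: t_adjoint_nth[OF J] J_nth mat_adjoint_J_mat)
    next
      case False
      then show ?thesis
        \<comment> \<open>For \<open>0 < k < p\<close> the negated index \<open>p - k\<close> is
          again nonzero, so both sides are entries of zero slices.\<close>
        using that * by (simp add: t_adjoint_nth[OF J] J_nth mat_adjoint_index[of _ "2 * n" "2 * n"])
    qed
    show "t_adjoint (t_J n p) ! ((r + p - s) mod p) $$ (i, j) =
        (- bcirc (t_J n p)) $$ (r * (2 * n) + i, s * (2 * n) + j)"
      using block_index_less[OF *(1,3)] block_index_less[OF *(2,4)] bcirc_carrier[OF J p] p
      by (simp add: slice bcirc_index[OF J *])
  qed
  then show ?thesis by (simp add: bcirc_t_adjoint[OF J p])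
qed


section \<open>Exponentials of T-Hamiltonian tensors\<close>

theorem proposition3p13:
  fixes n p :: nat and H :: "complex tensor"
  assumes "n \<ge> 1" and "p \<ge> 1"
    and "H \<in> carrier_tensor (2 * n) (2 * n) p"
    and "t_hamiltonian n p H"
  shows "t_symplectic n p (t_exp H)"
proof -
  have p: "0 < p" using assms(2) by simp
  note H = assms(3) and J = t_J_carrier[OF p, of n]
  note S = t_exp_carrier[OF H p]
  note S' = t_adjoint_carrier[OF S]
  note SJ = t_prod_carrier[OF S' J]
  define B where "B = bcirc H"
  define K where "K = bcirc (t_J n p)"
  let ?N = "2 * n * p"
  have B: "B \<in> carrier_mat ?N ?N" unfolding B_def by (rule bcirc_carrier[OF H p])
  have K: "K \<in> carrier_mat ?N ?N" unfolding K_def by (rule bcirc_carrier[OF J p])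
  have mB: "- B \<in> carrier_mat ?N ?N" using B by simp
  note B' = mat_adjoint_carrier[OF B]
  have "mat_adjoint (K * B) = K * B"
    using assms(4) bcirc_t_adjoint[OF t_prod_carrier[OF J H] p] bcirc_t_prod[OF J H p]
    by (simp add: t_hamiltonian_def B_def K_def)
  \<comment> \<open>The adjoint reverses the product, and skew-Hermitian \<open>K\<close>
    contributes the sign, which next moves over to \<open>B\<close>.\<close>
  then have "mat_adjoint B * (- K) = K * B"
    using mat_adjoint_mult[OF K B] mat_adjoint_bcirc_t_J[OF p, of n] by (simp add: K_def)
  then have "mat_adjoint B * K = K * (- B)"
    using B B' K by (metis carrier_matD uminus_mult_right_mat uminus_uminus_mat)
  then have tw: "mat_exp (mat_adjoint B) * K = K * mat_exp (- B)"
    by (rule mat_exp_intertwine[OF B' mB K])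
  have "bcirc (t_adjoint (t_exp H) *\<^sub>T t_J n p *\<^sub>T t_exp H) = mat_adjoint (mat_exp B) * K * mat_exp B"
    by (simp add: bcirc_t_prod[OF SJ S p] bcirc_t_prod[OF S' J p] bcirc_t_adjoint[OF S p]
        bcirc_t_exp[OF H p] B_def K_def)
  also have "\<dots> = K * (mat_exp (- B) * mat_exp B)"
    by (simp add: mat_adjoint_exp[OF B] tw assoc_mult_mat[OF K mat_exp_carrier[OF mB] mat_exp_carrier[OF B]])
  also have "\<dots> = K" using K by (simp add: mat_exp_uminus_mult[OF B])
  \<comment> \<open>Injectivity of \<open>bcirc\<close> brings the matrix identity back to
    tensors.\<close>
  finally have "t_adjoint (t_exp H) *\<^sub>T t_J n p *\<^sub>T t_exp H = t_J n p"
    unfolding K_def by (rule bcirc_inj[OF t_prod_carrier[OF SJ S] J])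
  then show ?thesis using S by (simp add: t_symplectic_def)
qed

end
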